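(* For every integer $n\geq 0$, \[ \sum_{k=0}^{n}(-1)^{n-k}\binom{n}{k}P_k(x^2)(1-x)^{2(n-k)}=x^n\binom{2n}{n}. \]
   Context: For $k\geq 0$, $P_k(x)=\sum_{j=0}^{k}\binom{k}{j}^2x^j$ denotes the type $B$ Narayana polynomial (so $P_0(x)=1$). *)

theory Defs
  imports "HOL-Computational_Algebra.Polynomial"
begin

definition narayana_B :: "nat \<Rightarrow> int poly" where
  "narayana_B k = (\<Sum>j=0..k. monom (int (k choose j) ^ 2) j)"

end

theory Submission
  imports Defs
begin

text \<open>
  \<open>P\<^sub>k(x\<^sup>2)\<close> is the constant term in \<open>t\<close> of \<open>((1 + x t)(1 + x/t))\<^sup>k\<close>, and
  \<open>(1 + x t)(1 + x/t) - (1 - x)\<^sup>2 = x (1 + t)\<^sup>2 / t\<close>. Hence the binomial theorem identifies the sum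
  with the constant term of \<open>(x (1 + t)\<^sup>2 / t)\<^sup>n\<close>. Multiplying by
  \<open>t\<^sup>n\<close> turns constant terms of Laurent polynomials into coefficients of \<open>t\<^sup>n\<close> in polynomials.
\<close>

text \<open>With t the polynomial variable, \<open>[:c, 1:]\<close> is t (1 + c/t), so extracting
  t^k takes the constant term of ((1 + c t)(1 + c/t))^k: pair t^j from one factor with t^(-j) from
  the other.\<close>

lemma coeff_binomial_product_power:
  fixes c :: "'a::comm_ring_1"
  shows "coeff (([:1, c:] * [:c, 1:]) ^ k) k = (\<Sum>j=0..k. of_nat (k choose j) ^ 2 * c ^ (2 * j))"
proof -
  have "coeff (([:1, c:] * [:c, 1:]) ^ k) k
      = (\<Sum>j\<le>k. coeff ([:1, c:] ^ k) j * coeff ([:c, 1:] ^ k) (k - j))"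
    by (simp only: power_mult_distrib coeff_mult)
  also have "\<dots> = (\<Sum>j\<le>k. of_nat (k choose j) ^ 2 * c ^ (2 * j))"
  proof (rule sum.cong)
    fix j assume "j \<in> {..k}"
    then show "coeff ([:1, c:] ^ k) j * coeff ([:c, 1:] ^ k) (k - j)
        = of_nat (k choose j) ^ 2 * c ^ (2 * j)"
      by (simp add: coeff_linear_poly_power binomial_symmetric[of j k] power2_eq_square
          mult_2_right power_add mult_ac)
  qed simp
  finally show ?thesis
    by (simp add: atMost_atLeast0)
qed

lemma pcompose_monom:
  fixes q :: "'a::comm_semiring_1 poly"
  shows "pcompose (monom a n) q = smult a (q ^ n)"
  by (induction n) (simp_all add: monom_0 monom_Suc pcompose_pCons)

lemma pcompose_narayana_B:
  "pcompose (narayana_B k) (q ^ 2) = (\<Sum>j=0..k. of_nat (k choose j) ^ 2 * q ^ (2 * j))"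
  by (simp add: narayana_B_def pcompose_sum pcompose_monom of_nat_poly power_mult power2_eq_square)

theorem theorem3p2:
  fixes n :: nat and x :: "int poly"
  defines "x \<equiv> [:0, 1:]"
  shows "(\<Sum>k=0..n. (-1) ^ (n - k) * of_nat (n choose k) * pcompose (narayana_B k) (x ^ 2)
            * (1 - x) ^ (2 * (n - k)))
         = x ^ n * of_nat (2 * n choose n)"
proof -
  \<comment> \<open>Two variables are nested: t is the outer one, and coefficients lie in Z[x]. Here
    \<open>A\<close> is t (1 + x t)(1 + x/t), and \<open>monom b 1\<close> below is -(1 - x)^2
    t.\<close>
  define A where "A = [:1, x:] * [:x, 1:]"
  define b where "b = - ((1 - x) ^ 2)"
  have A_k: "coeff (A ^ k) k = pcompose (narayana_B k) (x ^ 2)" for k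
    by (simp only: A_def coeff_binomial_product_power pcompose_narayana_B)
  have "A + monom b 1 = smult x ([:1, 1:] ^ 2)"
    by (simp add: A_def b_def monom_altdef power2_eq_square algebra_simps)
  then have "(A + monom b 1) ^ n = smult (x ^ n) ([:1, 1:] ^ (2 * n))"
    by (simp add: smult_power power_mult)
  then have "coeff ((A + monom b 1) ^ n) n = x ^ n * of_nat (2 * n choose n)"
    by (simp add: coeff_linear_poly_power)
  moreover have "coeff ((A + monom b 1) ^ n) n
      = (\<Sum>k\<le>n. of_nat (n choose k) * coeff (monom (b ^ (n - k)) (n - k) * A ^ k) n)"
    by (simp add: binomial_ring coeff_sum monom_power of_nat_poly mult_ac)
  moreover have "\<dots> = (\<Sum>k=0..n. (-1) ^ (n - k) * of_nat (n choose k)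
      * pcompose (narayana_B k) (x ^ 2) * (1 - x) ^ (2 * (n - k)))"
  proof (rule sum.cong)
    fix k assume "k \<in> {0..n}"
    \<comment> \<open>As k \<le> n, the factor t^(n-k) shifts the coefficient of t^n down to that of
      t^k in \<open>A ^ k\<close>, where \<open>A_k\<close> applies.\<close>
    then have "coeff (monom (b ^ (n - k)) (n - k) * A ^ k) n = b ^ (n - k) * pcompose (narayana_B k) (x ^ 2)"
      by (simp add: coeff_monom_mult A_k)
    moreover have "b ^ (n - k) = (-1) ^ (n - k) * (1 - x) ^ (2 * (n - k))"
      by (simp add: b_def power_minus[of "(1 - x) ^ 2"] power_mult)
    ultimately show "of_nat (n choose k) * coeff (monom (b ^ (n - k)) (n - k) * A ^ k) n
        = (-1) ^ (n - k) * of_nat (n choose k) * pcompose (narayana_B k) (x ^ 2) * (1 - x) ^ (2 * (n - k))"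
      by (simp add: mult_ac)
  qed (simp add: atMost_atLeast0)
  ultimately show ?thesis
    by simp
qed

end
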